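(* Let $(A,1,\Delta,\varepsilon,S,\alpha,\beta)$ be a rigid weak bialgebra satisfying $\varepsilon\circ S=\varepsilon$. Then $S$ is bijective if and only if $S(1)=1$.
   Context: $K$ is a field and all spaces are finite dimensional over $K$. A weak bialgebra $(A,1,\Delta,\varepsilon)$ is a unital associative $K$-algebra $(A,1)$ which is also a coassociative coalgebra with coproduct $\Delta$ and counit $\varepsilon$, such that $\Delta(ab)=\Delta(a)\Delta(b)$ for all $a,b$; neither $\Delta(1)=1\otimes1$ nor multiplicativity of $\varepsilon$ is required. Sweedler notation is used. $A$ is monoidal if $\varepsilon(abc)=\varepsilon(ab_{(1)})\varepsilon(b_{(2)}c)=\varepsilon(ab_{(2)})\varepsilon(b_{(1)}c)$ for all $a,b,c\in A$. Put $\varepsilon_{LR}(a)=\varepsilon(1_{(1)}a)1_{(2)}$ and $\varepsilon_{RL}(a)=1_{(1)}\varepsilon(a1_{(2)})$. For a linear map $S:A\to A$ with $S(ab)=S(b)S(a)$ and $x,a\in A$ write $x\triangleleft_Sa=S(a_{(1)})xa_{(2)}$ and $a\,{}_S\!\triangleright x=a_{(1)}xS(a_{(2)})$. A rigidity structure $(S,\alpha,\beta)$ on a monoidal weak bialgebra $A$ consists of a linear map $S:A\to A$ with $S(ab)=S(b)S(a)$ (not assumed unital) and elements $\alpha,\beta\in A$ such that $\alpha\triangleleft_S1=\alpha$, $1\,{}_S\!\triangleright\beta=\beta$, for all $a\in A$ $$\alpha\triangleleft_Sa=\alpha\triangleleft_S\varepsilon_{RL}(a),\qquad a\,{}_S\!\triangleright\beta=\varepsilon_{LR}(a)\,{}_S\!\triangleright\beta,$$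 and $$1_{(1)}\beta S(1_{(2)})\alpha1_{(3)}=1,\qquad S(1_{(1)})\alpha1_{(2)}\beta S(1_{(3)})=S(1).$$ A rigid weak bialgebra $(A,1,\Delta,\varepsilon,S,\alpha,\beta)$ is a monoidal weak bialgebra with a rigidity structure $(S,\alpha,\beta)$. *)

theory Defs
  imports Complex_Main "HOL-Library.Function_Algebras"
begin

section \<open>Tensor products of vector spaces over a field\<close>

text \<open>
  The tensor product of two vector spaces is realised inside the linear dual of the space of
  bilinear forms: the pure tensor of x and y is evaluation at (x, y), and the tensor product
  is the span of the pure tensors. Evaluation is extended by 0 to functions that are not bilinear
  forms, so that equality of tensors is equality in HOL. The universal property is proved below
  (\<open>tensor_lift_exists\<close>, \<open>tensor_lift_unique\<close>), so this is the usual tensor product.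
\<close>

definition bilinear_map ::
  "('k::field \<Rightarrow> 'a::ab_group_add \<Rightarrow> 'a) \<Rightarrow> ('k \<Rightarrow> 'b::ab_group_add \<Rightarrow> 'b) \<Rightarrow>
   ('k \<Rightarrow> 'c::ab_group_add \<Rightarrow> 'c) \<Rightarrow> ('a \<Rightarrow> 'b \<Rightarrow> 'c) \<Rightarrow> bool" where
  "bilinear_map s1 s2 s3 f \<longleftrightarrow>
     (\<forall>x. Vector_Spaces.linear s2 s3 (\<lambda>y. f x y)) \<and> (\<forall>y. Vector_Spaces.linear s1 s3 (\<lambda>x. f x y))"

type_synonym ('k, 'a, 'b) tensor = "('a \<Rightarrow> 'b \<Rightarrow> 'k) \<Rightarrow> 'k"

definition tensor_scale :: "'k::field \<Rightarrow> ('k, 'a, 'b) tensor \<Rightarrow> ('k, 'a, 'b) tensor" where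
  "tensor_scale c t = (\<lambda>B. c * t B)"

definition pure_tensor ::
  "('k::field \<Rightarrow> 'a::ab_group_add \<Rightarrow> 'a) \<Rightarrow> ('k \<Rightarrow> 'b::ab_group_add \<Rightarrow> 'b) \<Rightarrow>
   'a \<Rightarrow> 'b \<Rightarrow> ('k, 'a, 'b) tensor" where
  "pure_tensor s1 s2 x y = (\<lambda>B. if bilinear_map s1 s2 (*) B then B x y else 0)"

definition tensor_space ::
  "('k::field \<Rightarrow> 'a::ab_group_add \<Rightarrow> 'a) \<Rightarrow> ('k \<Rightarrow> 'b::ab_group_add \<Rightarrow> 'b) \<Rightarrow>
   ('k, 'a, 'b) tensor set" where
  "tensor_space s1 s2 = module.span tensor_scale {pure_tensor s1 s2 x y | x y. True}"

text \<open>
  The linear map induced by a bilinear map f. It is determined on \<open>tensor_space s1 s2\<close> only;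
  outside this subspace it is an arbitrary linear extension.
\<close>

definition tensor_lift ::
  "('k::field \<Rightarrow> 'a::ab_group_add \<Rightarrow> 'a) \<Rightarrow> ('k \<Rightarrow> 'b::ab_group_add \<Rightarrow> 'b) \<Rightarrow>
   ('k \<Rightarrow> 'c::ab_group_add \<Rightarrow> 'c) \<Rightarrow> ('a \<Rightarrow> 'b \<Rightarrow> 'c) \<Rightarrow> ('k, 'a, 'b) tensor \<Rightarrow> 'c" where
  "tensor_lift s1 s2 s3 f =
     (SOME g. Vector_Spaces.linear tensor_scale s3 g \<and> (\<forall>x y. g (pure_tensor s1 s2 x y) = f x y))"

lemma vector_space_field: "vector_space ((*) :: 'k::field \<Rightarrow> 'k \<Rightarrow> 'k)"
  by unfold_locales (simp_all add: algebra_simps)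

lemma vector_space_tensor:
  "vector_space (tensor_scale :: 'k::field \<Rightarrow> ('k, 'a, 'b) tensor \<Rightarrow> ('k, 'a, 'b) tensor)"
  by unfold_locales (simp_all add: tensor_scale_def fun_eq_iff algebra_simps)

lemma bilinear_pure_tensor:
  assumes "vector_space s1" "vector_space s2"
  shows "bilinear_map s1 s2 tensor_scale (pure_tensor s1 s2)"
proof -
  have lin2: "B x (y + y') = B x y + B x y'" "B x (s2 c y) = c * B x y"
    and lin1: "B (x + x') y = B x y + B x' y" "B (s1 c x) y = c * B x y"
    if "bilinear_map s1 s2 (*) B" for B x x' y y' c
    using that by (simp_all add: bilinear_map_def Vector_Spaces.linear_iff)
  show ?thesis
    unfolding bilinear_map_def[of s1 s2 tensor_scale] Vector_Spaces.linear_iff[of _ tensor_scale]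
    using assms vector_space_tensor
    by (simp add: pure_tensor_def tensor_scale_def fun_eq_iff lin1 lin2)
qed

lemma bilinear_eq_on_bases:
  assumes f: "bilinear_map s1 s2 s3 f" and g: "bilinear_map s1 s2 s3 g"
    and B1: "module.span s1 B1 = UNIV" and B2: "module.span s2 B2 = UNIV"
    and eq: "\<And>b b'. b \<in> B1 \<Longrightarrow> b' \<in> B2 \<Longrightarrow> f b b' = g b b'"
  shows "f x y = g x y"
proof -
  have *: "f b y = g b y" if b: "b \<in> B1" for b y
  proof -
    have l: "Vector_Spaces.linear s2 s3 (\<lambda>y. f b y)" "Vector_Spaces.linear s2 s3 (\<lambda>y. g b y)"
      using f g by (auto simp: bilinear_map_def)
    interpret p: vector_space_pair s2 s3
      using l(1) by (simp add: Vector_Spaces.linear_def vector_space_pair_def)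
    show ?thesis
      using p.linear_eq_on[OF l, of y B2] B2 eq b by simp
  qed
  have l: "Vector_Spaces.linear s1 s3 (\<lambda>x. f x y)" "Vector_Spaces.linear s1 s3 (\<lambda>x. g x y)"
    using f g by (auto simp: bilinear_map_def)
  interpret p: vector_space_pair s1 s3
    using l(1) by (simp add: Vector_Spaces.linear_def vector_space_pair_def)
  show ?thesis
    using p.linear_eq_on[OF l, of x B1] B1 * by simp
qed

lemma bilinear_compose_linear:
  assumes "bilinear_map s1 s2 s3 f" and "Vector_Spaces.linear s3 s4 g"
  shows "bilinear_map s1 s2 s4 (\<lambda>x y. g (f x y))"
  using assms by (simp add: bilinear_map_def Vector_Spaces.linear_iff)

theorem tensor_lift_exists:
  assumes v1: "vector_space s1" and v2: "vector_space s2" and f: "bilinear_map s1 s2 s3 f"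
  shows "\<exists>g. Vector_Spaces.linear tensor_scale s3 g \<and> (\<forall>x y. g (pure_tensor s1 s2 x y) = f x y)"
proof -
  interpret V1: vector_space s1 by (rule v1)
  interpret V2: vector_space s2 by (rule v2)
  interpret V3: vector_space s3
    using f by (auto simp: bilinear_map_def Vector_Spaces.linear_def)
  interpret F: vector_space "(*) :: 'a \<Rightarrow> 'a \<Rightarrow> 'a" by (rule vector_space_field)
  interpret T: vector_space "tensor_scale :: 'a \<Rightarrow> ('a, 'b, 'c) tensor \<Rightarrow> ('a, 'b, 'c) tensor"
    by (rule vector_space_tensor)
  interpret P1: vector_space_pair s1 "(*) :: 'a \<Rightarrow> 'a \<Rightarrow> 'a" ..
  interpret P2: vector_space_pair s2 "(*) :: 'a \<Rightarrow> 'a \<Rightarrow> 'a" ..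
  interpret PT: vector_space_pair "tensor_scale :: 'a \<Rightarrow> ('a, 'b, 'c) tensor \<Rightarrow> ('a, 'b, 'c) tensor" s3 ..
  obtain B1 where i1: "V1.independent B1" and s1: "UNIV \<subseteq> V1.span B1"
    by (rule V1.basis_exists[of UNIV])
  have B1: "V1.independent B1" "V1.span B1 = UNIV"
    using i1 top.extremum_uniqueI[OF s1] by simp_all
  obtain B2 where i2: "V2.independent B2" and s2: "UNIV \<subseteq> V2.span B2"
    by (rule V2.basis_exists[of UNIV])
  have B2: "V2.independent B2" "V2.span B2 = UNIV"
    using i2 top.extremum_uniqueI[OF s2] by simp_all
  let ?t = "\<lambda>(x, y). pure_tensor s1 s2 x y"
  have dual: "\<exists>B. bilinear_map s1 s2 (*) B \<and>
      (\<forall>x\<in>B1. \<forall>y\<in>B2. B x y = (if x = b \<and> y = b' then 1 else 0))" for b b'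
  proof -
    obtain p where p: "Vector_Spaces.linear s1 (*) p" "\<forall>x\<in>B1. p x = (if x = b then 1 else 0)"
      using P1.linear_independent_extend[OF B1(1), of "\<lambda>x. if x = b then 1 else 0"] by blast
    obtain q where q: "Vector_Spaces.linear s2 (*) q" "\<forall>x\<in>B2. q x = (if x = b' then 1 else 0)"
      using P2.linear_independent_extend[OF B2(1), of "\<lambda>x. if x = b' then 1 else 0"] by blast
    have "bilinear_map s1 s2 (*) (\<lambda>x y. p x * q y)"
    proof -
      have "p (x + x') = p x + p x'" "p (s1 c x) = c * p x" for x x' c
        using p(1) by (simp_all add: Vector_Spaces.linear_iff)
      moreover have "q (y + y') = q y + q y'" "q (s2 c y) = c * q y" for y y' c
        using q(1) by (simp_all add: Vector_Spaces.linear_iff)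
      ultimately show ?thesis
        by (simp add: bilinear_map_def Vector_Spaces.linear_iff v1 v2 vector_space_field distrib_left distrib_right mult.left_commute)
    qed
    then show ?thesis
      using p(2) q(2) by (intro exI[of _ "\<lambda>x y. p x * q y"] conjI ballI) simp_all
  qed
  define B where "B b b' = (SOME B. bilinear_map s1 s2 (*) B \<and>
      (\<forall>x\<in>B1. \<forall>y\<in>B2. B x y = (if x = b \<and> y = b' then 1 else 0)))" for b b'
  have B: "bilinear_map s1 s2 (*) (B b b')"
    "\<And>x y. x \<in> B1 \<Longrightarrow> y \<in> B2 \<Longrightarrow> B b b' x y = (if x = b \<and> y = b' then 1 else 0)" for b b'
    using someI_ex[OF dual, of b b'] unfolding B_def[symmetric] by blast+
  have tB: "?t z (B b b') = (if z = (b, b') then 1 else 0)" if "z \<in> B1 \<times> B2" for z b b'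
    using that B(1) B(2)[of "fst z" "snd z" b b']
    by (cases z) (simp add: pure_tensor_def)
  have inj: "inj_on ?t (B1 \<times> B2)"
  proof (rule inj_onI)
    fix z w assume z: "z \<in> B1 \<times> B2" and w: "w \<in> B1 \<times> B2" and e: "?t z = ?t w"
    obtain b b' where zb: "z = (b, b')" by (cases z)
    have "(if w = (b, b') then 1 else 0 :: 'a) = 1"
      using tB[OF z, of b b'] tB[OF w, of b b'] unfolding e unfolding zb by simp
    then have "w = (b, b')" by (rule contrapos_pp) simp
    then show "z = w" using zb by (simp only:)
  qed
  have ev: "(\<Sum>v\<in>A. tensor_scale (u v) v) C = (\<Sum>v\<in>A. u v * v C)"
    if "finite A" for A u and C :: "'b \<Rightarrow> 'c \<Rightarrow> 'a"
    using that by induction (simp_all add: tensor_scale_def)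
  have coeff: "u v = 0"
    if fin: "finite A" and sub: "A \<subseteq> ?t ` (B1 \<times> B2)"
      and zero: "(\<Sum>v\<in>A. tensor_scale (u v) v) = 0" and v: "v \<in> A"
    for A and u :: "('a, 'b, 'c) tensor \<Rightarrow> 'a" and v :: "('a, 'b, 'c) tensor"
  proof -
    obtain b b' where b: "(b, b') \<in> B1 \<times> B2" "v = ?t (b, b')"
    proof (rule imageE[OF subsetD[OF sub v]])
      fix z assume "v = ?t z" "z \<in> B1 \<times> B2"
      then show thesis using that[of "fst z" "snd z"] by (simp only: prod.collapse)
    qed
    have val: "w (B b b') = (if w = v then 1 else 0)" if w: "w \<in> A" for w
    proof -
      obtain z where z: "w = ?t z" "z \<in> B1 \<times> B2"
        by (rule imageE[OF subsetD[OF sub w]])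
      have "w = v \<longleftrightarrow> z = (b, b')"
        unfolding z(1) b(2) by (rule inj_on_eq_iff[OF inj z(2) b(1)])
      then show ?thesis using tB[OF z(2), of b b'] unfolding z(1)[symmetric] by (simp only:)
    qed
    have "u w * w (B b b') = (if w = v then u w else 0)" if "w \<in> A" for w
      unfolding val[OF that] by simp
    then have "(\<Sum>w\<in>A. u w * w (B b b')) = (\<Sum>w\<in>A. if w = v then u w else 0)"
      by (rule sum.cong[OF refl])
    also have "\<dots> = u v" using fin v by simp
    finally have "(\<Sum>w\<in>A. u w * w (B b b')) = u v" .
    with ev[OF fin, of u "B b b'"] show "u v = 0"
      unfolding zero zero_fun_apply by (simp only:)
  qed
  have ind: "T.independent (?t ` (B1 \<times> B2))"
    unfolding T.independent_explicit_module using coeff by iprover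
  obtain g where g: "Vector_Spaces.linear tensor_scale s3 g"
    "\<forall>t\<in>?t ` (B1 \<times> B2). g t = (case inv_into (B1 \<times> B2) ?t t of (x, y) \<Rightarrow> f x y)"
    using PT.linear_independent_extend[OF ind,
        of "\<lambda>t. case inv_into (B1 \<times> B2) ?t t of (x, y) \<Rightarrow> f x y"] by (elim exE conjE)
  have "g (pure_tensor s1 s2 b b') = f b b'" if "b \<in> B1" "b' \<in> B2" for b b'
  proof -
    have z: "(b, b') \<in> B1 \<times> B2" using that by simp
    show ?thesis using bspec[OF g(2) imageI[OF z]] inv_into_f_f[OF inj z] by simp
  qed
  note on_bases = this
  have "g (pure_tensor s1 s2 x y) = f x y" for x y
    by (rule bilinear_eq_on_bases[OF bilinear_compose_linear[OF bilinear_pure_tensor[OF v1 v2] g(1)]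
          f B1(2) B2(2) on_bases])
  with g(1) show ?thesis by blast
qed

theorem tensor_lift_unique:
  assumes "Vector_Spaces.linear tensor_scale s3 g" "Vector_Spaces.linear tensor_scale s3 h"
    and "\<And>x y. g (pure_tensor s1 s2 x y) = h (pure_tensor s1 s2 x y)"
    and "t \<in> tensor_space s1 s2"
  shows "g t = h t"
proof -
  interpret p: vector_space_pair
    "tensor_scale :: 'a \<Rightarrow> ('a, 'b, 'c) tensor \<Rightarrow> ('a, 'b, 'c) tensor" s3
    using assms(1) by (simp add: Vector_Spaces.linear_def vector_space_pair_def)
  show ?thesis
    using p.linear_eq_on[OF assms(1,2) assms(4)[unfolded tensor_space_def]] assms(3) by blast
qed

corollary tensor_lift:
  assumes "vector_space s1" "vector_space s2" "bilinear_map s1 s2 s3 f"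
  shows "Vector_Spaces.linear tensor_scale s3 (tensor_lift s1 s2 s3 f)"
    and "tensor_lift s1 s2 s3 f (pure_tensor s1 s2 x y) = f x y"
  using someI_ex[OF tensor_lift_exists[OF assms]] unfolding tensor_lift_def by auto


section \<open>Weak bialgebras\<close>

text \<open>
  The sort \<open>{ring, monoid_mult}\<close> is that of unital rings in which \<open>0 = 1\<close> is allowed.
\<close>

locale fin_dim_algebra = vector_space scale
  for scale :: "'k::field \<Rightarrow> 'a::{ring, monoid_mult} \<Rightarrow> 'a" +
  assumes finite_dimensional: "\<exists>Basis. finite_dimensional_vector_space scale Basis"
    and scale_mult_left: "scale c x * y = scale c (x * y)"
    and scale_mult_right: "x * scale c y = scale c (x * y)"

definition tensor_mult ::
  "('k::field \<Rightarrow> 'a::{ring, monoid_mult} \<Rightarrow> 'a) \<Rightarrow>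
   ('k, 'a, 'a) tensor \<Rightarrow> ('k, 'a, 'a) tensor \<Rightarrow> ('k, 'a, 'a) tensor" where
  "tensor_mult s t u =
     tensor_lift s s tensor_scale (\<lambda>x y.
       tensor_lift s s tensor_scale (\<lambda>x' y'. pure_tensor s s (x * x') (y * y')) u) t"

text \<open>
  Coassociativity is stated in \<open>A \<otimes> (A \<otimes> A)\<close>: the left-hand side is the image of
  \<open>(\<Delta> \<otimes> id) (\<Delta> a)\<close> under the associator.
\<close>

locale weak_bialgebra = fin_dim_algebra scale
  for scale :: "'k::field \<Rightarrow> 'a::{ring, monoid_mult} \<Rightarrow> 'a" +
  fixes \<Delta> :: "'a \<Rightarrow> ('k, 'a, 'a) tensor"
    and \<epsilon> :: "'a \<Rightarrow> 'k"
  assumes \<Delta>_tensor: "\<Delta> a \<in> tensor_space scale scale"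
    and \<Delta>_linear: "Vector_Spaces.linear scale tensor_scale \<Delta>"
    and \<epsilon>_linear: "Vector_Spaces.linear scale (*) \<epsilon>"
    and coassoc:
      "tensor_lift scale scale tensor_scale (\<lambda>x z.
         tensor_lift scale scale tensor_scale (\<lambda>u v.
           pure_tensor scale tensor_scale u (pure_tensor scale scale v z)) (\<Delta> x)) (\<Delta> a) =
       tensor_lift scale scale tensor_scale (\<lambda>x y.
         pure_tensor scale tensor_scale x (\<Delta> y)) (\<Delta> a)"
    and counit_left: "tensor_lift scale scale scale (\<lambda>x y. scale (\<epsilon> x) y) (\<Delta> a) = a"
    and counit_right: "tensor_lift scale scale scale (\<lambda>x y. scale (\<epsilon> y) x) (\<Delta> a) = a"
    and \<Delta>_mult: "\<Delta> (a * b) = tensor_mult scale (\<Delta> a) (\<Delta> b)"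
begin

text \<open>
  Sweedler notation: \<open>sweedler2 s f a\<close> is $f(a_{(1)}, a_{(2)})$ and \<open>sweedler3 s f a\<close> is
  $f(a_{(1)}, a_{(2)}, a_{(3)})$, for a multilinear map f into the space with scalar
  multiplication s.
\<close>

definition sweedler2 :: "('k \<Rightarrow> 'c::ab_group_add \<Rightarrow> 'c) \<Rightarrow> ('a \<Rightarrow> 'a \<Rightarrow> 'c) \<Rightarrow> 'a \<Rightarrow> 'c" where
  "sweedler2 s f a = tensor_lift scale scale s f (\<Delta> a)"

definition sweedler3 :: "('k \<Rightarrow> 'c::ab_group_add \<Rightarrow> 'c) \<Rightarrow> ('a \<Rightarrow> 'a \<Rightarrow> 'a \<Rightarrow> 'c) \<Rightarrow> 'a \<Rightarrow> 'c" where
  "sweedler3 s f a = sweedler2 s (\<lambda>x z. sweedler2 s (\<lambda>u v. f u v z) x) a"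

definition \<epsilon>_LR :: "'a \<Rightarrow> 'a" where
  "\<epsilon>_LR a = sweedler2 scale (\<lambda>x y. scale (\<epsilon> (x * a)) y) 1"

definition \<epsilon>_RL :: "'a \<Rightarrow> 'a" where
  "\<epsilon>_RL a = sweedler2 scale (\<lambda>x y. scale (\<epsilon> (a * y)) x) 1"

definition right_act :: "('a \<Rightarrow> 'a) \<Rightarrow> 'a \<Rightarrow> 'a \<Rightarrow> 'a" where
  "right_act S x a = sweedler2 scale (\<lambda>u v. S u * x * v) a"

definition left_act :: "('a \<Rightarrow> 'a) \<Rightarrow> 'a \<Rightarrow> 'a \<Rightarrow> 'a" where
  "left_act S a x = sweedler2 scale (\<lambda>u v. u * x * S v) a"

end

locale monoidal_weak_bialgebra = weak_bialgebra scale \<Delta> \<epsilon>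
  for scale :: "'k::field \<Rightarrow> 'a::{ring, monoid_mult} \<Rightarrow> 'a"
    and \<Delta> :: "'a \<Rightarrow> ('k, 'a, 'a) tensor" and \<epsilon> :: "'a \<Rightarrow> 'k" +
  assumes monoidal1: "\<epsilon> (a * b * c) = sweedler2 (*) (\<lambda>x y. \<epsilon> (a * x) * \<epsilon> (y * c)) b"
    and monoidal2: "\<epsilon> (a * b * c) = sweedler2 (*) (\<lambda>x y. \<epsilon> (a * y) * \<epsilon> (x * c)) b"

locale rigid_weak_bialgebra = monoidal_weak_bialgebra scale \<Delta> \<epsilon>
  for scale :: "'k::field \<Rightarrow> 'a::{ring, monoid_mult} \<Rightarrow> 'a"
    and \<Delta> :: "'a \<Rightarrow> ('k, 'a, 'a) tensor" and \<epsilon> :: "'a \<Rightarrow> 'k" +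
  fixes S :: "'a \<Rightarrow> 'a" and \<alpha> \<beta> :: 'a
  assumes S_linear: "Vector_Spaces.linear scale scale S"
    and S_mult: "S (a * b) = S b * S a"
    and \<alpha>_unit: "right_act S \<alpha> 1 = \<alpha>"
    and \<beta>_unit: "left_act S 1 \<beta> = \<beta>"
    and \<alpha>_act: "right_act S \<alpha> a = right_act S \<alpha> (\<epsilon>_RL a)"
    and \<beta>_act: "left_act S a \<beta> = left_act S (\<epsilon>_LR a) \<beta>"
    and rigid1: "sweedler3 scale (\<lambda>x y z. x * \<beta> * S y * \<alpha> * z) 1 = 1"
    and rigid2: "sweedler3 scale (\<lambda>x y z. S x * \<alpha> * y * \<beta> * S z) 1 = S 1"

end

(*
  If S is onto, S(1) is a unit on the image of S, hence equal to 1. Conversely, let S(1) = 1.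
  Rigidity makes the dual functor V |-> V* on modules fully faithful, and this means that S is an
  epimorphism of rings in the following sense: algebra maps (or anti-algebra maps) g, h with
  g S = h S are equal. Explicitly, X = h(1_(1) beta S(1_(2))) g(alpha 1_(3)) satisfies
  h(a) X = X g(a), and the zigzag identity together with S(1) = 1 gives X = 1.
  Hence every power of S is an epimorphism too. For large k the finite dimensional algebra A is the
  direct sum of the kernel I and the image B of S^(2k), and the projection onto B along I is an
  algebra map which agrees with the identity on B. So it is the identity, I = 0, and S is
  injective, hence bijective.
*)

theory Submission
  imports Defs
begin

section \<open>Stabilisation of the powers of an endomorphism\<close>

lemma (in vector_space) linear_funpow:
  assumes "Vector_Spaces.linear scale scale T"
  shows "Vector_Spaces.linear scale scale (T ^^ n)"
  using assms by (induction n) (simp_all add: Vector_Spaces.linear_iff)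

text \<open>Ranges decrease and kernels increase with the exponent. Beyond an exponent of least
  range dimension and one of greatest kernel dimension, nested subspaces of equal dimension
  coincide.\<close>

lemma (in fin_dim_algebra) powers_stabilise:
  assumes T: "Vector_Spaces.linear scale scale T"
  shows "\<exists>n. \<forall>m\<ge>n. range (T ^^ m) = range (T ^^ n) \<and> (T ^^ m) -` {0} = (T ^^ n) -` {0}"
proof -
  obtain B where "finite_dimensional_vector_space scale B"
    using finite_dimensional by blast
  then interpret FD: finite_dimensional_vector_space scale B .
  have lin': "(T ^^ n) (x + y) = (T ^^ n) x + (T ^^ n) y" "(T ^^ n) (scale c x) = scale c ((T ^^ n) x)"
    for n x y c
    using linear_funpow[OF T, of n] by (simp_all add: Vector_Spaces.linear_iff)
  have zero: "(T ^^ n) 0 = 0" for n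
    using lin'(2)[of n 0 0] by simp
  have sub_range: "subspace (range (T ^^ n))" for n
    unfolding subspace_def
    by (auto simp: lin'[symmetric] zero intro: range_eqI[where x = 0])
  have sub_ker: "subspace ((T ^^ n) -` {0})" for n
    unfolding subspace_def by (simp add: lin' zero)
  have range_mono: "range (T ^^ m) \<subseteq> range (T ^^ n)" if "n \<le> m" for m n
    using that funpow_add[of n "m - n" T] by auto
  have ker_mono: "(T ^^ n) -` {0} \<subseteq> (T ^^ m) -` {0}" if "n \<le> m" for m n
    using that funpow_add[of "m - n" n T] zero[of "m - n"] by auto
  obtain p where p: "\<And>m. dim (range (T ^^ p)) \<le> dim (range (T ^^ m))"
    using ex_has_least_nat[of "\<lambda>_. True" _ "\<lambda>n. dim (range (T ^^ n))"] by auto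
  have "dim ((T ^^ n) -` {0}) < Suc (dim UNIV)" for n
    using FD.dim_subset[OF subset_UNIV] by (simp add: less_Suc_eq_le)
  then obtain q where q: "\<And>m. dim ((T ^^ m) -` {0}) \<le> dim ((T ^^ q) -` {0})"
    using ex_has_greatest_nat[of "\<lambda>_. True" 0 "\<lambda>n. dim ((T ^^ n) -` {0})" "Suc (dim UNIV)"] by auto
  have range_p: "range (T ^^ m) = range (T ^^ p)" if "p \<le> m" for m
    using FD.subspace_dim_equal[OF sub_range sub_range range_mono[OF that] p] .
  have ker_q: "(T ^^ m) -` {0} = (T ^^ q) -` {0}" if "q \<le> m" for m
    using FD.subspace_dim_equal[OF sub_ker sub_ker ker_mono[OF that] q] by simp
  show ?thesis
  proof (intro exI allI impI conjI)
    fix m assume "max p q \<le> m"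
    then show "range (T ^^ m) = range (T ^^ max p q)" "(T ^^ m) -` {0} = (T ^^ max p q) -` {0}"
      using range_p[of m] range_p[of "max p q"] ker_q[of m] ker_q[of "max p q"] by simp_all
  qed
qed

section \<open>Sweedler sums as finite sums over chosen representatives\<close>

context weak_bialgebra
begin

definition coprod_terms :: "'a \<Rightarrow> ('a \<times> 'a) list" where
  "coprod_terms a = (SOME xs. \<Delta> a = (\<Sum>(x, y)\<leftarrow>xs. pure_tensor scale scale x y))"

text \<open>
  The value depends on the choice made in \<open>coprod_terms\<close> unless f is bilinear. The gain over
  \<open>sweedler2\<close> is that finite sums commute with additive maps and with each other without any
  condition on f.
\<close>

definition sw :: "('a \<Rightarrow> 'a \<Rightarrow> 'c::comm_monoid_add) \<Rightarrow> 'a \<Rightarrow> 'c" where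
  "sw f a = (\<Sum>(x, y)\<leftarrow>coprod_terms a. f x y)"

lemma vs: "vector_space scale" ..

text \<open>Scalars can be absorbed into the first factor, so a linear combination of pure tensors
  is a plain sum of pure tensors.\<close>

lemma tensor_eq_sum_list_pure:
  assumes "t \<in> tensor_space scale scale"
  shows "\<exists>xs. t = (\<Sum>(x, y)\<leftarrow>xs. pure_tensor scale scale x y)"
proof -
  interpret T: vector_space "tensor_scale :: 'k \<Rightarrow> ('k, 'a, 'a) tensor \<Rightarrow> ('k, 'a, 'a) tensor"
    by (rule vector_space_tensor)
  have bil: "tensor_scale c (pure_tensor scale scale x y) = pure_tensor scale scale (scale c x) y" for c x y
    using bilinear_pure_tensor[OF vs vs]
    by (simp add: bilinear_map_def Vector_Spaces.linear_iff)
  show ?thesis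
    using assms unfolding tensor_space_def
  proof (induction rule: T.span_induct_alt)
    case base
    show ?case by (rule exI[of _ "[]"]) simp
  next
    case (step c u t)
    then obtain x y xs where "u = pure_tensor scale scale x y"
      "t = (\<Sum>(x, y)\<leftarrow>xs. pure_tensor scale scale x y)" by blast
    then show ?case
      by (intro exI[of _ "(scale c x, y) # xs"]) (simp add: bil)
  qed
qed

lemma \<Delta>_eq_sw: "\<Delta> a = sw (pure_tensor scale scale) a"
  unfolding sw_def coprod_terms_def
  by (rule someI_ex[OF tensor_eq_sum_list_pure[OF \<Delta>_tensor]])

lemma sw_cong: "(\<And>x y. f x y = g x y) \<Longrightarrow> sw f a = sw g a"
  by (simp add: sw_def)

lemma sw_hom:
  fixes \<phi> :: "'c::ab_group_add \<Rightarrow> 'd::ab_group_add"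
  assumes "\<And>x y. \<phi> (x + y) = \<phi> x + \<phi> y"
  shows "\<phi> (sw f a) = sw (\<lambda>x y. \<phi> (f x y)) a"
proof -
  have "\<phi> 0 = 0" using assms[of 0 0] by simp
  then have "\<phi> (\<Sum>(x, y)\<leftarrow>xs. f x y) = (\<Sum>(x, y)\<leftarrow>xs. \<phi> (f x y))" for xs
    by (induction xs) (auto simp: assms)
  then show ?thesis by (simp add: sw_def)
qed

lemma sw_linear: "Vector_Spaces.linear s t \<phi> \<Longrightarrow> \<phi> (sw f a) = sw (\<lambda>x y. \<phi> (f x y)) a"
  by (rule sw_hom) (simp add: Vector_Spaces.linear_iff)

lemma sw_add: "sw (\<lambda>x y. f x y + g x y) a = sw f a + sw g a"
  unfolding sw_def case_prod_beta' by (rule sum_list_addf)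

lemma sw_mult_right: "b * sw f a = sw (\<lambda>x y. b * f x y) a" for b :: "'b::ring"
  by (rule sw_hom) (simp_all add: distrib_left)

lemma sw_mult_left: "sw f a * b = sw (\<lambda>x y. f x y * b) a" for b :: "'b::ring"
  by (rule sw_hom[where \<phi> = "\<lambda>x. x * b"]) (simp_all add: distrib_right)

lemma sw_scale: "vector_space s \<Longrightarrow> s c (sw f a) = sw (\<lambda>x y. s c (f x y)) a"
  by (rule sw_hom) (rule vector_space.vector_space_assms(1))

lemma sw_scale_left: "vector_space s \<Longrightarrow> s (sw f a) z = sw (\<lambda>x y. s (f x y) z) a"
  by (rule sw_hom[where \<phi> = "\<lambda>c. s c z"]) (rule vector_space.vector_space_assms(2))

lemma sw_swap: "sw (\<lambda>x y. sw (F x y) b) a = sw (\<lambda>u v. sw (\<lambda>x y. F x y u v) a) b"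
proof -
  have "sw (\<lambda>x y. \<Sum>(u, v)\<leftarrow>us. F x y u v) a = (\<Sum>(u, v)\<leftarrow>us. sw (\<lambda>x y. F x y u v) a)" for us
    by (induction us) (auto simp: sw_add, simp add: sw_def case_prod_beta')
  then show ?thesis by (simp add: sw_def[of _ b])
qed

abbreviation bil :: "('k \<Rightarrow> 'c::ab_group_add \<Rightarrow> 'c) \<Rightarrow> ('a \<Rightarrow> 'a \<Rightarrow> 'c) \<Rightarrow> bool" where
  "bil \<equiv> bilinear_map scale scale"

lemma bilI:
  assumes "vector_space s"
    and "\<And>x y z. f (x + y) z = f x z + f y z" "\<And>x y z. f z (x + y) = f z x + f z y"
    and "\<And>c x y. f (scale c x) y = s c (f x y)" "\<And>c x y. f x (scale c y) = s c (f x y)"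
  shows "bil s f"
  using assms vs by (simp add: bilinear_map_def Vector_Spaces.linear_iff)

lemma bilD:
  assumes "bil s f"
  shows "vector_space s"
    and "f (x + y) z = f x z + f y z" "f z (x + y) = f z x + f z y"
    and "f (scale c x) y = s c (f x y)" "f x (scale c y) = s c (f x y)"
  using assms by (simp_all add: bilinear_map_def Vector_Spaces.linear_iff)

text \<open>The lift sees only the tensor, so for bilinear \<open>f\<close> the choice in
  \<open>coprod_terms\<close> is immaterial. This is the bridge between the axioms and
  \<open>sw\<close>.\<close>

lemma lift_\<Delta>:
  assumes "bil s f"
  shows "tensor_lift scale scale s f (\<Delta> a) = sw f a"
  using sw_linear[OF tensor_lift(1)[OF vs vs assms]] tensor_lift(2)[OF vs vs assms]
  by (simp add: \<Delta>_eq_sw)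

lemma sweedler2_eq_sw: "bil s f \<Longrightarrow> sweedler2 s f a = sw f a"
  by (simp add: sweedler2_def lift_\<Delta>)

text \<open>The lists chosen for two elements and for their sum are unrelated, so linearity in the
  argument has to come from the lift composed with \<Delta>.\<close>

lemma linear_sw:
  assumes "bil s f"
  shows "Vector_Spaces.linear scale s (sw f)"
proof -
  have "Vector_Spaces.linear scale s (tensor_lift scale scale s f \<circ> \<Delta>)"
    by (rule Vector_Spaces.linear_compose[OF \<Delta>_linear tensor_lift(1)[OF vs vs assms]])
  then show ?thesis by (simp add: lift_\<Delta>[OF assms] o_def)
qed

lemma sw_arg:
  assumes "bil s f"
  shows "sw f (a + b) = sw f a + sw f b" "sw f (scale c a) = s c (sw f a)"
  using linear_sw[OF assms] by (simp_all add: Vector_Spaces.linear_iff)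

lemma bil_sw:
  assumes "vector_space s" "\<And>u v. bil s (\<lambda>x y. F x y u v)"
  shows "bil s (\<lambda>x y. sw (F x y) b)"
  by (rule bilI)
    (simp_all only: assms(1) sw_add[symmetric] sw_scale[OF assms(1)] bilD[OF assms(2)] cong: sw_cong)

lemma sw_mult:
  assumes f: "bil s f"
  shows "sw f (a * b) = sw (\<lambda>x y. sw (\<lambda>x' y'. f (x * x') (y * y')) b) a"
proof -
  note bp = bilinear_pure_tensor[OF vs vs]
  have b1: "bil tensor_scale (\<lambda>x' y'. pure_tensor scale scale (x * x') (y * y'))" for x y
    by (rule bilI) (simp_all add: vector_space_tensor bilD[OF bp] distrib_left scale_mult_right)
  have b2: "bil tensor_scale (\<lambda>x y. pure_tensor scale scale (x * x') (y * y'))" for x' y'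
    by (rule bilI) (simp_all add: vector_space_tensor bilD[OF bp] distrib_right scale_mult_left)
  have "\<Delta> (a * b) = sw (\<lambda>x y. sw (\<lambda>x' y'. pure_tensor scale scale (x * x') (y * y')) b) a"
    unfolding \<Delta>_mult tensor_mult_def lift_\<Delta>[OF b1]
    by (rule lift_\<Delta>[OF bil_sw[OF vector_space_tensor b2]])
  then show ?thesis
    using lift_\<Delta>[OF f, of "a * b"] tensor_lift(2)[OF vs vs f]
    by (simp add: sw_linear[OF tensor_lift(1)[OF vs vs f]])
qed

definition trilinear :: "('a \<Rightarrow> 'a \<Rightarrow> 'a \<Rightarrow> 'a) \<Rightarrow> bool" where
  "trilinear f \<longleftrightarrow> (\<forall>x. bil scale (f x)) \<and> (\<forall>y z. Vector_Spaces.linear scale scale (\<lambda>x. f x y z))"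

lemma trilinearI:
  assumes "\<And>x y u v. f (x + y) u v = f x u v + f y u v" "\<And>x y u v. f u (x + y) v = f u x v + f u y v"
    "\<And>x y u v. f u v (x + y) = f u v x + f u v y"
    "\<And>c x u v. f (scale c x) u v = scale c (f x u v)" "\<And>c x u v. f u (scale c x) v = scale c (f u x v)"
    "\<And>c x u v. f u v (scale c x) = scale c (f u v x)"
  shows "trilinear f"
  using assms vs by (simp add: trilinear_def bilinear_map_def Vector_Spaces.linear_iff)

text \<open>
  The map on \<open>A \<otimes> (A \<otimes> A)\<close> is written in coordinates of the first factor, because
  \<open>tensor_lift\<close> depends linearly on the bilinear map only on the tensor space itself, whereas
  the lift from \<open>A \<otimes> (A \<otimes> A)\<close> asks for bilinearity on the whole ambient space.
\<close>

lemma sw_coassoc: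
  assumes f: "trilinear f"
  shows "sw (\<lambda>w z. sw (\<lambda>x y. f x y z) w) a = sw (\<lambda>x w. sw (f x) w) a"
proof -
  obtain B where fd: "finite_dimensional_vector_space scale B"
    using finite_dimensional by blast
  interpret FD: finite_dimensional_vector_space scale B by (rule fd)
  let ?T = "tensor_scale :: 'k \<Rightarrow> ('k, 'a, 'a) tensor \<Rightarrow> ('k, 'a, 'a) tensor"
  have vT: "vector_space ?T" by (rule vector_space_tensor)
  define G where "G u t = (\<Sum>b\<in>B. scale (representation B u b) (tensor_lift scale scale scale (f b) t))"
    for u t
  have fb: "bil scale (f b)" for b using f by (simp add: trilinear_def)
  have lift_lin: "tensor_lift scale scale scale (f b) (t + t') =
      tensor_lift scale scale scale (f b) t + tensor_lift scale scale scale (f b) t'"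
    "tensor_lift scale scale scale (f b) (tensor_scale c t) =
      scale c (tensor_lift scale scale scale (f b) t)" for b c t t'
    using tensor_lift(1)[OF vs vs fb] by (simp_all add: Vector_Spaces.linear_iff)
  have B: "independent B" "x \<in> span B" for x
    using FD.independent_Basis FD.span_Basis by simp_all
  have G: "bilinear_map scale ?T scale G"
    unfolding bilinear_map_def Vector_Spaces.linear_iff
    by (simp add: vs vT G_def lift_lin representation_add[OF B(1) B(2) B(2)]
        representation_scale[OF B(1) B(2)] scale_right_distrib scale_left_distrib sum.distrib
        scale_sum_right mult.commute)
  have G_pure: "G u (pure_tensor scale scale v z) = f u v z" for u v z
  proof -
    interpret Vector_Spaces.linear scale scale "\<lambda>x. f x v z" using f by (simp add: trilinear_def)
    have "f u v z = f (\<Sum>b\<in>B. scale (representation B u b) b) v z"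
      by (simp add: sum_representation_eq[OF B(1) B(2) FD.finite_Basis])
    also have "\<dots> = G u (pure_tensor scale scale v z)"
      by (simp add: sum scale G_def tensor_lift(2)[OF vs vs fb])
    finally show ?thesis by simp
  qed
  let ?p = "pure_tensor scale scale" and ?q = "pure_tensor scale ?T"
  note bp = bilinear_pure_tensor[OF vs vs] and bq = bilinear_pure_tensor[OF vs vT]
  have q: "?q (x + x') t = ?q x t + ?q x' t" "?q x (t + t') = ?q x t + ?q x t'"
    "?q (scale c x) t = tensor_scale c (?q x t)" "?q x (tensor_scale c t) = tensor_scale c (?q x t)"
    for x x' t t' c
    using bq by (simp_all add: bilinear_map_def Vector_Spaces.linear_iff)
  have b1: "bil tensor_scale (\<lambda>u v. ?q u (?p v z))" for z
    by (rule bilI) (simp_all add: vector_space_tensor q bilD[OF bp])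
  have b2: "bil tensor_scale (\<lambda>x z. sw (\<lambda>u v. ?q u (?p v z)) x)"
    by (rule bilI) (simp_all add: vector_space_tensor sw_arg[OF b1] q bilD[OF bp] sw_add
        sw_scale[OF vector_space_tensor])
  have \<Delta>_lin: "\<Delta> (x + y) = \<Delta> x + \<Delta> y" "\<Delta> (scale c x) = tensor_scale c (\<Delta> x)" for x y c
    using \<Delta>_linear by (simp_all add: Vector_Spaces.linear_iff)
  have b3: "bil tensor_scale (\<lambda>x y. ?q x (\<Delta> y))"
    by (rule bilI) (simp_all add: vector_space_tensor q \<Delta>_lin)
  have eq: "sw (\<lambda>w z. sw (\<lambda>x y. ?q x (?p y z)) w) a = sw (\<lambda>x w. ?q x (\<Delta> w)) a"
    using coassoc[of a] by (simp only: lift_\<Delta>[OF b1] lift_\<Delta>[OF b2] lift_\<Delta>[OF b3])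
  \<comment> \<open>\<open>?H\<close> sends the pure tensor of \<open>x\<close>, \<open>y\<close>,
    \<open>z\<close> to \<open>f x y z\<close>; applied to \<open>eq\<close> it turns the
    coassociativity axiom into the claim.\<close>
  let ?H = "tensor_lift scale ?T scale G"
  note H = tensor_lift[OF vs vT G]
  have "G x (\<Delta> w) = sw (f x) w" for x w
    using G by (simp add: \<Delta>_eq_sw bilinear_map_def sw_linear[of ?T scale "G x"] G_pure)
  then show ?thesis
    using arg_cong[OF eq, of ?H] by (simp add: sw_linear[OF H(1)] H(2) G_pure)
qed

lemma \<epsilon>_lin: "\<epsilon> (x + y) = \<epsilon> x + \<epsilon> y" "\<epsilon> (scale c x) = c * \<epsilon> x"
  using \<epsilon>_linear by (simp_all add: Vector_Spaces.linear_iff)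

lemmas lin_simps = distrib_left distrib_right scale_mult_left scale_mult_right
  scale_right_distrib scale_left_distrib \<epsilon>_lin sw_add sw_scale[OF vs] mult.assoc

lemma sw_counit: "sw (\<lambda>x y. scale (\<epsilon> x) y) a = a" "sw (\<lambda>x y. scale (\<epsilon> y) x) a = a"
proof -
  have "bil scale (\<lambda>x y. scale (\<epsilon> x) y)" "bil scale (\<lambda>x y. scale (\<epsilon> y) x)"
    by (rule bilI; simp add: vs lin_simps mult.commute)+
  from this[THEN lift_\<Delta>] show "sw (\<lambda>x y. scale (\<epsilon> x) y) a = a" "sw (\<lambda>x y. scale (\<epsilon> y) x) a = a"
    using counit_left[of a] counit_right[of a] by simp_all
qed

lemma \<epsilon>_LR_eq_sw: "\<epsilon>_LR a = sw (\<lambda>x y. scale (\<epsilon> (x * a)) y) 1"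
  unfolding \<epsilon>_LR_def by (rule sweedler2_eq_sw, rule bilI) (simp_all add: vs lin_simps mult.commute)

lemma \<epsilon>_RL_eq_sw: "\<epsilon>_RL a = sw (\<lambda>x y. scale (\<epsilon> (a * y)) x) 1"
  unfolding \<epsilon>_RL_def by (rule sweedler2_eq_sw, rule bilI) (simp_all add: vs lin_simps mult.commute)

end

section \<open>Monoidality: moving an element onto one leg of the coproduct of 1\<close>

context monoidal_weak_bialgebra
begin

lemma monoidal_sw:
  "\<epsilon> (a * b * c) = sw (\<lambda>x y. \<epsilon> (a * x) * \<epsilon> (y * c)) b"
  "\<epsilon> (a * b * c) = sw (\<lambda>x y. \<epsilon> (a * y) * \<epsilon> (x * c)) b"
proof -
  have "bil (*) (\<lambda>x y. \<epsilon> (a * x) * \<epsilon> (y * c))" "bil (*) (\<lambda>x y. \<epsilon> (a * y) * \<epsilon> (x * c))"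
    by (rule bilI; simp add: vector_space_field lin_simps algebra_simps)+
  from this[THEN sweedler2_eq_sw] show
    "\<epsilon> (a * b * c) = sw (\<lambda>x y. \<epsilon> (a * x) * \<epsilon> (y * c)) b"
    "\<epsilon> (a * b * c) = sw (\<lambda>x y. \<epsilon> (a * y) * \<epsilon> (x * c)) b"
    using monoidal1[of a b c] monoidal2[of a b c] by simp_all
qed

text \<open>The first monoidal identity with \<open>b\<close> in the middle splits the factor
  \<open>\<epsilon> (a * b * y)\<close>; then the sums over \<open>b\<close> and over 1 are
  interchanged.\<close>

lemma \<epsilon>_RL_mult: "\<epsilon>_RL (a * b) = sw (\<lambda>x y. scale (\<epsilon> (a * x)) (\<epsilon>_RL y)) b"
  by (simp add: \<epsilon>_RL_eq_sw monoidal_sw(1)[of a b] sw_scale_left[OF vs] sw_scale[OF vs])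
    (rule sw_swap)

text \<open>Here \<open>a\<close> is in the middle; the two monoidal identities give the two orders
  of its legs.\<close>

lemma \<epsilon>_LR_mult:
  "\<epsilon>_LR (a * b) = sw (\<lambda>x y. scale (\<epsilon> (y * b)) (\<epsilon>_LR x)) a"
  "\<epsilon>_LR (a * b) = sw (\<lambda>x y. scale (\<epsilon> (x * b)) (\<epsilon>_LR y)) a"
proof -
  show "\<epsilon>_LR (a * b) = sw (\<lambda>x y. scale (\<epsilon> (y * b)) (\<epsilon>_LR x)) a"
    by (simp add: \<epsilon>_LR_eq_sw mult.assoc[symmetric] monoidal_sw(1)[of _ a b] sw_scale_left[OF vs]
        sw_scale[OF vs])
      (subst sw_swap, simp add: mult.commute)
  show "\<epsilon>_LR (a * b) = sw (\<lambda>x y. scale (\<epsilon> (x * b)) (\<epsilon>_LR y)) a"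
    by (simp add: \<epsilon>_LR_eq_sw mult.assoc[symmetric] monoidal_sw(2)[of _ a b] sw_scale_left[OF vs]
        sw_scale[OF vs])
      (subst sw_swap, simp add: mult.commute)
qed

text \<open>Write \<open>a\<close> as \<open>a * 1\<close>. By \<open>\<epsilon>_RL_mult\<close> the
  second argument a_(2) 1_(2) may be replaced by \<epsilon>(a_(2) 1_(2)) 1_(3); after rebracketing,
  the counit axiom for \<open>a * 1_(1)\<close> collapses the first two legs.\<close>

lemma sw_\<epsilon>_RL_right:
  assumes G: "bil scale G" and inv: "\<And>x y. G x (\<epsilon>_RL y) = G x y"
  shows "sw G a = sw (\<lambda>x y. G (a * x) y) 1"
proof -
  note GD = bilD(2-)[OF G]
  have lin2: "Vector_Spaces.linear scale scale (G x)"
    and lin1: "Vector_Spaces.linear scale scale (\<lambda>x. G x y)" for x y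
    using G by (simp_all add: bilinear_map_def)
  have 1: "G x (y * y') = sw (\<lambda>r s. scale (\<epsilon> (y * r)) (G x s)) y'" for x y y'
    using inv[of x "y * y'"] by (simp add: \<epsilon>_RL_mult sw_linear[OF lin2] GD inv)
  have 2: "sw (\<lambda>x' y'. G (x * x') (y * y')) 1 =
      sw (\<lambda>w s. sw (\<lambda>x' r. scale (\<epsilon> (y * r)) (G (x * x') s)) w) 1" for x y
    unfolding 1
    by (rule sw_coassoc[symmetric], rule trilinearI) (simp_all add: lin_simps GD mult.commute)
  have b: "bil scale (\<lambda>x y. scale (\<epsilon> y) (G x s))" for s
    by (rule bilI) (simp_all add: vs lin_simps GD mult.commute)
  have 3: "sw (\<lambda>x y. sw (\<lambda>x' r. scale (\<epsilon> (y * r)) (G (x * x') s)) w) a = G (a * w) s" for w s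
    using sw_mult[OF b[of s], of a w] sw_linear[OF lin1[of s], of "\<lambda>x y. scale (\<epsilon> y) x" "a * w"]
    by (simp add: sw_counit GD)
  have "sw G a = sw G (a * 1)" by simp
  also have "\<dots> = sw (\<lambda>x y. sw (\<lambda>w s. sw (\<lambda>x' r. scale (\<epsilon> (y * r)) (G (x * x') s)) w) 1) a"
    unfolding sw_mult[OF G] 2 ..
  also have "\<dots> = sw (\<lambda>x y. G (a * x) y) 1"
    by (subst sw_swap) (simp add: 3)
  finally show ?thesis .
qed

text \<open>Mirror image with \<open>1 * a\<close>: the first argument 1_(1) a_(1) becomes 1_(1)
  \<epsilon>(1_(2) a_(1)), and the counit collapses the last two legs.\<close>

lemma sw_\<epsilon>_LR_left:
  assumes G: "bil scale G" and inv: "\<And>x y. G (\<epsilon>_LR x) y = G x y"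
  shows "sw G a = sw (\<lambda>x y. G x (y * a)) 1"
proof -
  note GD = bilD(2-)[OF G]
  have lin2: "Vector_Spaces.linear scale scale (G x)"
    and lin1: "Vector_Spaces.linear scale scale (\<lambda>x. G x y)" for x y
    using G by (simp_all add: bilinear_map_def)
  have 1: "G (x' * x) y = sw (\<lambda>r s. scale (\<epsilon> (s * x)) (G r y)) x'" for x x' y
    using inv[of "x' * x" y] by (simp add: \<epsilon>_LR_mult(1) sw_linear[OF lin1] GD inv)
  have 2: "sw (\<lambda>x' y'. G (x' * x) (y' * y)) 1 =
      sw (\<lambda>r w. sw (\<lambda>s y'. scale (\<epsilon> (s * x)) (G r (y' * y))) w) 1" for x y
    unfolding 1
    by (rule sw_coassoc, rule trilinearI) (simp_all add: lin_simps GD mult.commute)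
  have b: "bil scale (\<lambda>x y. scale (\<epsilon> x) (G r y))" for r
    by (rule bilI) (simp_all add: vs lin_simps GD mult.commute)
  have 3: "sw (\<lambda>x y. sw (\<lambda>s y'. scale (\<epsilon> (s * x)) (G r (y' * y))) w) a = G r (w * a)" for w r
    using sw_mult[OF b[of r], of w a] sw_linear[OF lin2[of r], of "\<lambda>x y. scale (\<epsilon> x) y" "w * a"]
    by (subst sw_swap) (simp add: sw_counit GD)
  have "sw G a = sw G (1 * a)" by simp
  also have "\<dots> = sw (\<lambda>x y. sw (\<lambda>r w. sw (\<lambda>s y'. scale (\<epsilon> (s * x)) (G r (y' * y))) w) 1) a"
    unfolding sw_mult[OF G] by (subst sw_swap) (simp only: 2)
  also have "\<dots> = sw (\<lambda>x y. G x (y * a)) 1"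
    by (subst sw_swap) (simp add: 3)
  finally show ?thesis .
qed

text \<open>Again with \<open>1 * a\<close>, but the second argument is expanded. This takes the
  other order of legs in \<open>\<epsilon>_LR_mult\<close>, that is, the second monoidal
  identity.\<close>

lemma sw_\<epsilon>_LR_right:
  assumes G: "bil scale G" and inv: "\<And>x y. G x (\<epsilon>_LR y) = G x y"
  shows "sw G a = sw (\<lambda>x y. G (x * a) y) 1"
proof -
  note GD = bilD(2-)[OF G]
  have lin2: "Vector_Spaces.linear scale scale (G x)"
    and lin1: "Vector_Spaces.linear scale scale (\<lambda>x. G x y)" for x y
    using G by (simp_all add: bilinear_map_def)
  have 1: "G x (y' * y) = sw (\<lambda>r s. scale (\<epsilon> (r * y)) (G x s)) y'" for x y y'
    using inv[of x "y' * y"] by (simp add: \<epsilon>_LR_mult(2) sw_linear[OF lin2] GD inv)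
  have 2: "sw (\<lambda>x' y'. G (x' * x) (y' * y)) 1 =
      sw (\<lambda>w s. sw (\<lambda>x' r. scale (\<epsilon> (r * y)) (G (x' * x) s)) w) 1" for x y
    unfolding 1
    by (rule sw_coassoc[symmetric], rule trilinearI) (simp_all add: lin_simps GD mult.commute)
  have b: "bil scale (\<lambda>x y. scale (\<epsilon> y) (G x s))" for s
    by (rule bilI) (simp_all add: vs lin_simps GD mult.commute)
  have 3: "sw (\<lambda>x y. sw (\<lambda>x' r. scale (\<epsilon> (r * y)) (G (x' * x) s)) w) a = G (w * a) s" for w s
    using sw_mult[OF b[of s], of w a] sw_linear[OF lin1[of s], of "\<lambda>x y. scale (\<epsilon> y) x" "w * a"]
    by (subst sw_swap) (simp add: sw_counit GD)
  have "sw G a = sw G (1 * a)" by simp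
  also have "\<dots> = sw (\<lambda>x y. sw (\<lambda>w s. sw (\<lambda>x' r. scale (\<epsilon> (r * y)) (G (x' * x) s)) w) 1) a"
    unfolding sw_mult[OF G] by (subst sw_swap) (simp only: 2)
  also have "\<dots> = sw (\<lambda>x y. G (x * a) y) 1"
    by (subst sw_swap) (simp add: 3)
  finally show ?thesis .
qed

end

section \<open>Zigzag identities for arbitrary elements\<close>

context rigid_weak_bialgebra
begin

lemma S_lin: "S (x + y) = S x + S y" "S (scale c x) = scale c (S x)"
  using S_linear by (simp_all add: Vector_Spaces.linear_iff)

definition act_\<alpha> :: "'a \<Rightarrow> 'a" where "act_\<alpha> a = sw (\<lambda>x y. S x * \<alpha> * y) a"
definition act_\<beta> :: "'a \<Rightarrow> 'a" where "act_\<beta> a = sw (\<lambda>x y. x * \<beta> * S y) a"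

lemma bil_acts: "bil scale (\<lambda>x y. S x * \<alpha> * y)" "bil scale (\<lambda>x y. x * \<beta> * S y)"
  by (rule bilI; simp add: vs lin_simps S_lin)+

lemma act_lin:
  "act_\<alpha> (x + y) = act_\<alpha> x + act_\<alpha> y" "act_\<alpha> (scale c x) = scale c (act_\<alpha> x)"
  "act_\<beta> (x + y) = act_\<beta> x + act_\<beta> y" "act_\<beta> (scale c x) = scale c (act_\<beta> x)"
  unfolding act_\<alpha>_def act_\<beta>_def by (simp_all only: sw_arg[OF bil_acts(1)] sw_arg[OF bil_acts(2)])

lemma act_\<alpha>_\<epsilon>_RL: "act_\<alpha> (\<epsilon>_RL a) = act_\<alpha> a"
  using \<alpha>_act[of a] by (simp add: act_\<alpha>_def right_act_def sweedler2_eq_sw[OF bil_acts(1)])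

lemma act_\<beta>_\<epsilon>_LR: "act_\<beta> (\<epsilon>_LR a) = act_\<beta> a"
  using \<beta>_act[of a] by (simp add: act_\<beta>_def left_act_def sweedler2_eq_sw[OF bil_acts(2)])

text \<open>For \<open>a = 1\<close> this is the second rigidity identity, rebracketed. Since
  \<open>act_\<beta>\<close> is invariant under \<open>\<epsilon>_LR\<close>, a general
  \<open>a\<close> can be moved onto the first leg, where anti-multiplicativity pulls out
  \<open>S a\<close> on the left.\<close>

lemma S_zigzag_right: "sw (\<lambda>x y. S x * \<alpha> * act_\<beta> y) a = S a"
proof -
  have t: "trilinear (\<lambda>x y z. S x * \<alpha> * y * \<beta> * S z)"
    by (rule trilinearI) (simp_all add: lin_simps S_lin)
  have b: "bil scale (\<lambda>x y. S x * \<alpha> * y * \<beta> * S z)" for z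
    by (rule bilI) (simp_all add: vs lin_simps S_lin)
  have b': "bil scale (\<lambda>w z. sw (\<lambda>x y. S x * \<alpha> * y * \<beta> * S z) w)"
    by (rule bilI) (simp_all add: vs sw_arg[OF b], simp_all add: lin_simps S_lin)
  have "S 1 = sw (\<lambda>w z. sw (\<lambda>x y. S x * \<alpha> * y * \<beta> * S z) w) 1"
    using rigid2 unfolding sweedler3_def sweedler2_eq_sw[OF b] sweedler2_eq_sw[OF b'] by simp
  also have "\<dots> = sw (\<lambda>x y. S x * \<alpha> * act_\<beta> y) 1"
    unfolding sw_coassoc[OF t] by (simp add: act_\<beta>_def sw_mult_right mult.assoc)
  finally have 1: "sw (\<lambda>x y. S x * \<alpha> * act_\<beta> y) 1 = S 1" ..
  have "bil scale (\<lambda>x y. S x * \<alpha> * act_\<beta> y)"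
    by (rule bilI) (simp_all add: vs lin_simps S_lin act_lin)
  then have "sw (\<lambda>x y. S x * \<alpha> * act_\<beta> y) a = sw (\<lambda>x y. S (x * a) * \<alpha> * act_\<beta> y) 1"
    by (rule sw_\<epsilon>_LR_right) (simp add: act_\<beta>_\<epsilon>_LR)
  also have "\<dots> = S a * S 1"
    by (simp add: 1[symmetric] S_mult sw_mult_right mult.assoc)
  \<comment> \<open>The factor \<open>S 1\<close> is absorbed because
    \<open>S a * S 1 = S (1 * a)\<close>.\<close>
  also have "\<dots> = S a" using S_mult[of 1 a] by simp
  finally show ?thesis .
qed

lemma S_zigzag_left: "sw (\<lambda>x y. act_\<alpha> x * \<beta> * S y) a = S a"
proof -
  have t: "trilinear (\<lambda>x y z. S x * \<alpha> * y * \<beta> * S z)"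
    by (rule trilinearI) (simp_all add: lin_simps S_lin)
  show ?thesis
    using sw_coassoc[OF t, of a] S_zigzag_right[of a]
    by (simp add: act_\<alpha>_def act_\<beta>_def sw_mult_left sw_mult_right mult.assoc)
qed

section \<open>Cancellation of \<open>S\<close> and its powers on the right\<close>

text \<open>
  The witness X is the mate of the identity, viewed as a morphism between the duals of the
  modules given by g and h. The multiplication m is a parameter so that the lemma also covers
  anti-homomorphisms.
\<close>

lemma S_epi:
  fixes m :: "'a \<Rightarrow> 'a \<Rightarrow> 'a" (infixl "\<cdot>" 70)
  assumes m: "bil scale m" and m_assoc: "\<And>x y z. x \<cdot> y \<cdot> z = x \<cdot> (y \<cdot> z)"
    and m_one: "\<And>x. 1 \<cdot> x = x" "\<And>x. x \<cdot> 1 = x"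
    and g: "Vector_Spaces.linear scale scale g" "\<And>x y. g (x * y) = g x \<cdot> g y" "g 1 = 1"
    and h: "Vector_Spaces.linear scale scale h" "\<And>x y. h (x * y) = h x \<cdot> h y" "h 1 = 1"
    and gh: "\<And>x. g (S x) = h (S x)" and S_one: "S 1 = 1"
  shows "g a = h a"
proof -
  have lin: "g (x + y) = g x + g y" "g (scale c x) = scale c (g x)"
    "h (x + y) = h x + h y" "h (scale c x) = scale c (h x)" for x y c
    using g(1) h(1) by (simp_all add: Vector_Spaces.linear_iff)
  note mD = bilD(2-)[OF m]
  have sw_m: "x \<cdot> sw f b = sw (\<lambda>u v. x \<cdot> f u v) b" "sw f b \<cdot> x = sw (\<lambda>u v. f u v \<cdot> x) b" for x f b
    using m by (simp_all add: bilinear_map_def sw_linear[of scale scale "m x"]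
        sw_linear[of scale scale "\<lambda>y. y \<cdot> x"])
  note sws = sw_m sw_linear[OF g(1)] sw_linear[OF h(1)] sw_mult_left sw_mult_right
  note simps = lin_simps S_lin act_lin mD lin
  \<comment> \<open>\<open>C a\<close> is the common value of \<open>h a \<cdot> X\<close> and
    \<open>X \<cdot> g a\<close>.\<close>
  define C where "C a = sw (\<lambda>x y. h (x * \<beta>) \<cdot> g (act_\<alpha> y)) a" for a
  define X where "X = C 1"
  have "trilinear (\<lambda>x y z. h x \<cdot> h \<beta> \<cdot> g (S y) \<cdot> g (\<alpha> * z))"
    by (rule trilinearI) (simp_all add: simps)
  \<comment> \<open>The middle factor is a value of \<open>S\<close>, where \<open>g\<close> and
    \<open>h\<close> agree, so it passes from the \<open>g\<close> part to the \<open>h\<close>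
    part. The first form of \<open>C\<close> lets \<open>a\<close> move out to the left, the second
    to the right.\<close>
  from sw_coassoc[OF this] have C': "C a = sw (\<lambda>x y. h (act_\<beta> x) \<cdot> g (\<alpha> * y)) a" for a
    by (simp add: C_def act_\<alpha>_def act_\<beta>_def sws g h gh m_assoc mult.assoc)
  have "bil scale (\<lambda>x y. h (x * \<beta>) \<cdot> g (act_\<alpha> y))"
    by (rule bilI) (simp_all add: vs simps)
  then have "C a = sw (\<lambda>x y. h (a * x * \<beta>) \<cdot> g (act_\<alpha> y)) 1" for a
    unfolding C_def by (rule sw_\<epsilon>_RL_right) (simp add: act_\<alpha>_\<epsilon>_RL)
  then have hX: "h a \<cdot> X = C a" for a
    by (simp add: X_def C_def[of 1] sws h m_assoc m_one mult.assoc)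
  have "bil scale (\<lambda>x y. h (act_\<beta> x) \<cdot> g (\<alpha> * y))"
    by (rule bilI) (simp_all add: vs simps)
  then have "C a = sw (\<lambda>x y. h (act_\<beta> x) \<cdot> g (\<alpha> * (y * a))) 1" for a
    unfolding C' by (rule sw_\<epsilon>_LR_left) (simp add: act_\<beta>_\<epsilon>_LR)
  then have Xg: "X \<cdot> g a = C a" for a
    by (simp add: X_def C'[of 1] sws g m_assoc m_one mult.assoc)
  have "trilinear (\<lambda>p q v. h (p * \<beta>) \<cdot> g (act_\<alpha> q) \<cdot> g (\<beta> * S v))"
    by (rule trilinearI) (simp_all add: simps)
  note co = sw_coassoc[OF this]
  \<comment> \<open>Absorbing \<open>g u\<close> into \<open>X\<close> gives \<open>C u\<close>;
    after rebracketing, \<open>S_zigzag_left\<close> contracts the \<open>g\<close> part to a value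
    of \<open>S\<close>, which \<open>h\<close> takes over.\<close>
  have X_act_\<beta>: "X \<cdot> g (act_\<beta> y) = h (act_\<beta> y)" for y
  proof -
    have "X \<cdot> g (act_\<beta> y) = sw (\<lambda>u v. X \<cdot> g u \<cdot> g (\<beta> * S v)) y"
      by (simp add: act_\<beta>_def sws g m_assoc mult.assoc)
    also have "\<dots> = sw (\<lambda>u v. sw (\<lambda>p q. h (p * \<beta>) \<cdot> g (act_\<alpha> q) \<cdot> g (\<beta> * S v)) u) y"
      by (simp add: Xg C_def sws)
    also have "\<dots> = sw (\<lambda>p t. h (p * \<beta>) \<cdot> g (sw (\<lambda>q v. act_\<alpha> q * \<beta> * S v) t)) y"
      unfolding co by (simp add: sws g m_assoc mult.assoc)
    also have "\<dots> = h (act_\<beta> y)"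
      by (simp add: S_zigzag_left gh act_\<beta>_def sws h)
    finally show ?thesis .
  qed
  \<comment> \<open>Expand \<open>S 1\<close> by \<open>S_zigzag_right\<close>, carry
    \<open>X\<close> past \<open>h (act_\<beta> y)\<close>, where \<open>X_act_\<beta>\<close>
    absorbs it, and contract the expansion again.\<close>
  have "X = h (S 1) \<cdot> X" by (simp add: S_one h m_one)
  also have "\<dots> = sw (\<lambda>x y. h (S x * \<alpha>) \<cdot> (X \<cdot> g (act_\<beta> y))) 1"
    unfolding S_zigzag_right[of 1, symmetric] by (simp add: sws h m_assoc Xg hX)
  also have "\<dots> = h (S 1)"
    unfolding X_act_\<beta> S_zigzag_right[of 1, symmetric] by (simp add: sws h)
  finally have "X = 1" by (simp add: S_one h)
  then show ?thesis using hX[of a] Xg[of a] by (simp add: m_one)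
qed

text \<open>Induction peels off the innermost \<open>S\<close>: the composites of \<open>g\<close>
  and \<open>h\<close> with \<open>S ^^ n\<close> agree on the image of \<open>S\<close>, hence
  everywhere by \<open>S_epi\<close>.\<close>

lemma funpow_S_epi:
  assumes g: "Vector_Spaces.linear scale scale g" "\<And>x y. g (x * y) = g x * g y" "g 1 = 1"
    and h: "Vector_Spaces.linear scale scale h" "\<And>x y. h (x * y) = h x * h y" "h 1 = 1"
    and S_one: "S 1 = 1"
  shows "(\<And>x. g ((S ^^ n) x) = h ((S ^^ n) x)) \<Longrightarrow> g a = h a"
proof (induction n arbitrary: a)
  case (Suc n)
  \<comment> \<open>For odd \<open>n\<close> the power reverses products, so the composites are
    homomorphisms into the opposite algebra.\<close>
  define m where "m x y = (if even n then x * y else y * x)" for x y :: 'a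
  have pow_mult: "(S ^^ n) (x * y) = m ((S ^^ n) x) ((S ^^ n) y)" for x y
  proof -
    have "(S ^^ k) (x * y) = (if even k then (S ^^ k) x * (S ^^ k) y else (S ^^ k) y * (S ^^ k) x)" for k
      by (induction k) (simp_all add: S_mult)
    then show ?thesis by (simp add: m_def)
  qed
  have pow_one: "(S ^^ n) 1 = 1" by (induction n) (simp_all add: S_one)
  note lin = Vector_Spaces.linear_compose[OF linear_funpow[OF S_linear, of n]]
  have "g ((S ^^ n) x) = h ((S ^^ n) x)" for x
  proof (rule S_epi[where m = m and g = "g \<circ> (S ^^ n)" and h = "h \<circ> (S ^^ n)", unfolded o_apply])
    show "bil scale m" by (rule bilI) (simp_all add: m_def vs lin_simps)
    show "g ((S ^^ n) (S x)) = h ((S ^^ n) (S x))" for x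
      using Suc.prems[of x] by (simp add: funpow_swap1)
    show "Vector_Spaces.linear scale scale (\<lambda>x. g ((S ^^ n) x))"
      "Vector_Spaces.linear scale scale (\<lambda>x. h ((S ^^ n) x))"
      using lin[OF g(1)] lin[OF h(1)] by (simp_all only: o_def)
  qed (simp_all add: m_def mult.assoc pow_mult pow_one g(2,3) h(2,3) S_one)
  then show ?case by (rule Suc.IH)
qed simp

section \<open>Fitting decomposition and injectivity of \<open>S\<close>\<close>

lemma inj_S:
  assumes S_one: "S 1 = 1"
  shows "inj S"
proof -
  obtain n where n: "\<And>m. m \<ge> n \<Longrightarrow> range (S ^^ m) = range (S ^^ n) \<and> (S ^^ m) -` {0} = (S ^^ n) -` {0}"
    using powers_stabilise[OF S_linear] by blast
  obtain k where k: "n < k" using lessI by metis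
  \<comment> \<open>The even exponent makes \<phi> multiplicative; as it exceeds \<open>n\<close>,
    passing from \<phi> to its square changes neither range nor kernel.\<close>
  define \<phi> where "\<phi> = S ^^ (2 * k)"
  have \<phi>\<phi>: "\<phi> \<circ> \<phi> = S ^^ (4 * k)"
    unfolding \<phi>_def by (simp add: funpow_add[symmetric])
  have range: "range (\<phi> \<circ> \<phi>) = range \<phi>" and ker: "(\<phi> \<circ> \<phi>) -` {0} = \<phi> -` {0}"
    unfolding \<phi>\<phi> unfolding \<phi>_def using n[of "4 * k"] n[of "2 * k"] k by simp_all
  have \<phi>_linear: "Vector_Spaces.linear scale scale \<phi>"
    unfolding \<phi>_def by (rule linear_funpow[OF S_linear])
  then have \<phi>_lin: "\<phi> (x + y) = \<phi> x + \<phi> y" "\<phi> (scale c x) = scale c (\<phi> x)" for x y c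
    by (simp_all add: Vector_Spaces.linear_iff)
  have \<phi>_diff: "\<phi> x - \<phi> y = \<phi> (x - y)" for x y
    using \<phi>_lin(1)[of "x - y" y] by simp
  have \<phi>_mult: "\<phi> (x * y) = \<phi> x * \<phi> y" for x y
    unfolding \<phi>_def by (induction k) (simp_all add: S_mult)
  have \<phi>_one: "\<phi> 1 = 1"
    unfolding \<phi>_def by (induction k) (simp_all add: S_one)
  have inj: "u = v" if "u \<in> range \<phi>" "v \<in> range \<phi>" "\<phi> u = \<phi> v" for u v
  proof -
    obtain x y where xy: "u = \<phi> x" "v = \<phi> y" using \<open>u \<in> range \<phi>\<close> \<open>v \<in> range \<phi>\<close> by blast
    then have "\<phi> (\<phi> (x - y)) = 0"
      using that(3) by (simp add: \<phi>_diff[symmetric])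
    then have "x - y \<in> \<phi> -` {0}" unfolding ker[symmetric] by simp
    then show "u = v" by (simp add: xy \<phi>_diff[symmetric])
  qed
  have "\<exists>b. b \<in> range \<phi> \<and> \<phi> b = \<phi> a" for a
  proof -
    have "\<phi> a \<in> range (\<phi> \<circ> \<phi>)" unfolding range by simp
    then show ?thesis by auto
  qed
  \<comment> \<open>This is the projection onto the range of \<phi> along its kernel. As \<phi> is
    injective on its range, an identity for \<pi> can be checked after applying \<phi>, which is
    \<open>\<pi>I\<close>.\<close>
  then obtain \<pi> where \<pi>: "\<And>a. \<pi> a \<in> range \<phi>" "\<And>a. \<phi> (\<pi> a) = \<phi> a" by metis
  have \<pi>I: "\<pi> a = b" if "b \<in> range \<phi>" "\<phi> b = \<phi> a" for a b
    using inj[OF \<pi>(1) that(1)] that(2) \<pi>(2) by simp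
  have \<phi>_closed: "u + v \<in> range \<phi>" "u * v \<in> range \<phi>" "scale c u \<in> range \<phi>"
    if uv: "u \<in> range \<phi>" "v \<in> range \<phi>" for u v c
  proof -
    obtain x y where "u = \<phi> x" "v = \<phi> y" using uv by blast
    then show "u + v \<in> range \<phi>" "u * v \<in> range \<phi>" "scale c u \<in> range \<phi>"
      by (simp_all only: \<phi>_lin[symmetric] \<phi>_mult[symmetric] rangeI)
  qed
  have "\<pi> a = a" for a
  proof (rule funpow_S_epi[where n = "2 * k" and h = "\<lambda>x. x" and g = \<pi>])
    show "Vector_Spaces.linear scale scale \<pi>"
      by (auto simp: Vector_Spaces.linear_iff vs \<phi>_lin \<pi> intro!: \<pi>I \<phi>_closed)
    show "\<pi> (x * y) = \<pi> x * \<pi> y" for x y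
      by (rule \<pi>I) (simp_all add: \<phi>_closed \<phi>_mult \<pi>)
    show "\<pi> 1 = 1" by (rule \<pi>I) (metis \<phi>_one rangeI, rule refl)
    show "\<pi> ((S ^^ (2 * k)) x) = (S ^^ (2 * k)) x" for x
      by (rule \<pi>I) (simp_all add: \<phi>_def)
  qed (simp_all add: S_one Vector_Spaces.linear_iff vs)
  \<comment> \<open>Now the range of \<phi>, on which \<phi> is injective, is the whole
    algebra.\<close>
  then have "inj \<phi>" using \<pi>(1) inj by (metis injI)
  \<comment> \<open>\<open>S\<close> is applied first in its power, so injectivity passes to it;
    \<open>n < k\<close> ensures that the exponent is positive.\<close>
  have "S ^^ (2 * k) = S ^^ (2 * k - 1) \<circ> S"
    using k funpow_Suc_right[of "2 * k - 1" S] by (subst (asm) Suc_diff_1) simp_all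
  with \<open>inj \<phi>\<close> have "inj (S ^^ (2 * k - 1) \<circ> S)" by (simp only: \<phi>_def)
  then show ?thesis by (rule inj_on_imageI2)
qed

lemma bij_S_iff: "bij S \<longleftrightarrow> S 1 = 1"
proof
  assume "bij S"
  then obtain a where a: "S a = 1" by (metis bij_pointE)
  \<comment> \<open>With \<open>S a = 1\<close> both sides reduce, to 1 and to
    \<open>S 1\<close>.\<close>
  have "S (1 * a) = S a * S 1" by (rule S_mult)
  then show "S 1 = 1" by (simp add: a)
next
  assume "S 1 = 1"
  then have inj: "inj S" by (rule inj_S)
  obtain B where "finite_dimensional_vector_space scale B"
    using finite_dimensional by blast
  then interpret FD: finite_dimensional_vector_space scale B .
  show "bij S"
    using inj FD.linear_inj_imp_surj[OF S_linear inj] by (rule bijI)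
qed

end

theorem theoremB6:
  fixes scale :: "'k::field \<Rightarrow> 'a::{ring, monoid_mult} \<Rightarrow> 'a"
    and \<Delta> :: "'a \<Rightarrow> ('k, 'a, 'a) tensor" and \<epsilon> :: "'a \<Rightarrow> 'k"
    and S :: "'a \<Rightarrow> 'a" and \<alpha> \<beta> :: 'a
  assumes "rigid_weak_bialgebra scale \<Delta> \<epsilon> S \<alpha> \<beta>"
    and "\<epsilon> \<circ> S = \<epsilon>"
  shows "bij S \<longleftrightarrow> S 1 = 1"
  by (rule rigid_weak_bialgebra.bij_S_iff[OF assms(1)])

end
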